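(* Let $n$ be a positive integer. The universal restricted Hausdorff dimension $\dim_U$ on subsets of $\mathbb{R}^n$ has the following properties. (i) It is Lipschitz stable: $\dim_U f(A)\le\dim_U A$ for every $A\subset\mathbb{R}^n$ and every Lipschitz map $f\colon\mathbb{R}^n\to\mathbb{R}^n$. (ii) It is monotone: $A\subset B$ implies $\dim_U A\le\dim_U B$. (iii) $\dim_U S=\dim_H S$ for every self-similar set $S\subset\mathbb{R}^n$. (iv) It is $\sigma$-stable: $\dim_U\left(\bigcup_{i=1}^\infty A_i\right)=\sup_i\dim_U A_i$ for all $A_1,A_2,\ldots\subset\mathbb{R}^n$. (v) $\dim_H E\le\dim_H^D E\le\dim_U E\le\dim_P E$ for every $E\subset\mathbb{R}^n$ and every $D\in\mathcal{D}$.
   Context: $|E|$ denotes the diameter of a set $E$. $\mathcal{D}$ is the family of all sets $D\subset(0,\infty)$ with $\inf D=0$ that are open in the Sorgenfrey topology (generated by the intervals $[a,b)$), i.e. for every $t\in D$ there is $\delta>0$ with $[t,t+\delta)\subset D$. For $D\in\mathcal{D}$, $E\subset\mathbb{R}^n$ and $s\ge0$ let $$\mathcal{H}^s_{D,\infty}(E)=\inf\left\{\sum_{i=1}^\infty|E_i|^s: E\subset\bigcup_{i=1}^\infty E_i,\ |E_i|\in D\text{ for all }i\right\},\qquad \dim_H^D E=\inf\{s\ge0:\mathcal{H}^s_{D,\infty}(E)=0\}.$$ The universal restricted Hausdorff dimension is $\dim_U E=\sup\{\dim_H^D E: D\in\mathcal{D}\}$. $\dim_H$ and $\dim_P$ are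 the Hausdorff and packing dimensions. A self-similar set is a nonempty compact set $S$ with $S=\bigcup_{i=1}^m f_i(S)$ for finitely many contracting similarities $f_i$ of $\mathbb{R}^n$ (no separation condition is assumed). *)

theory Defs
  imports "HOL-Analysis.Analysis"
begin

text \<open>
  All dimensions take values in \<open>[0,\<infinity>]\<close>, so that no infimum or supremum below relies on
  a boundedness or nonemptiness side condition.
\<close>

text \<open>
  The library's \<open>Inf {}\<close> is unspecified on the reals, hence \<open>D \<noteq> {}\<close>, which is implicit in
  \<open>inf D = 0\<close>.
\<close>

definition sorgenfrey_family :: "real set set" where
  "sorgenfrey_family =
     {D. D \<subseteq> {0<..} \<and> D \<noteq> {} \<and> Inf D = 0 \<and> (\<forall>t\<in>D. \<exists>\<delta>>0. {t..<t+\<delta>} \<subseteq> D)}"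

text \<open>
  Boundedness of the covering sets is required explicitly, because \<open>diameter\<close> is a
  meaningless real number on unbounded sets; the mathematical diameter would be infinite.
\<close>

definition restricted_content :: "real set \<Rightarrow> real \<Rightarrow> 'a::metric_space set \<Rightarrow> ennreal" where
  "restricted_content D s E =
     (INF X \<in> {X :: nat \<Rightarrow> 'a set. E \<subseteq> (\<Union>i. X i) \<and> (\<forall>i. bounded (X i) \<and> diameter (X i) \<in> D)}.
        \<Sum>i. ennreal (diameter (X i) powr s))"

definition restricted_hausdorff_dim :: "real set \<Rightarrow> 'a::metric_space set \<Rightarrow> ennreal" where
  "restricted_hausdorff_dim D E = (INF s \<in> {s. 0 \<le> s \<and> restricted_content D s E = 0}. ennreal s)"

definition universal_dim :: "'a::metric_space set \<Rightarrow> ennreal" where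
  "universal_dim E = (SUP D \<in> sorgenfrey_family. restricted_hausdorff_dim D E)"

text \<open>
  The gauge \<open>|X|\<^sup>s\<close> with the usual conventions \<open>|{}|\<^sup>s = 0\<close> and \<open>0\<^sup>0 = 1\<close> for nonempty sets
  (whereas \<open>0 powr 0 = 0\<close>), so that \<open>hausdorff_measure 0\<close> is counting measure.
\<close>

definition diam_gauge :: "real \<Rightarrow> 'a::metric_space set \<Rightarrow> ennreal" where
  "diam_gauge s X =
     (if X = {} then 0 else if s = 0 then 1 else ennreal (diameter X powr s))"

definition hausdorff_premeasure :: "real \<Rightarrow> real \<Rightarrow> 'a::metric_space set \<Rightarrow> ennreal" where
  "hausdorff_premeasure \<delta> s E =
     (INF X \<in> {X :: nat \<Rightarrow> 'a set. E \<subseteq> (\<Union>i. X i) \<and> (\<forall>i. bounded (X i) \<and> diameter (X i) \<le> \<delta>)}.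
        \<Sum>i. diam_gauge s (X i))"

definition hausdorff_measure :: "real \<Rightarrow> 'a::metric_space set \<Rightarrow> ennreal" where
  "hausdorff_measure s E = (SUP \<delta> \<in> {0<..}. hausdorff_premeasure \<delta> s E)"

definition hausdorff_dim :: "'a::metric_space set \<Rightarrow> ennreal" where
  "hausdorff_dim E = (INF s \<in> {s. 0 \<le> s \<and> hausdorff_measure s E = 0}. ennreal s)"

text \<open>
  The packing dimension is defined through packing measures.  A \<open>\<delta>\<close>-packing of \<open>E\<close> is a set of
  pairs (centre, radius) whose closed balls are pairwise disjoint, with centres in \<open>E\<close> and radii
  in \<open>(0,\<delta>]\<close>; in Euclidean space such a set is automatically countable.
\<close>

definition packings :: "real \<Rightarrow> 'a::metric_space set \<Rightarrow> ('a \<times> real) set set" where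
  "packings \<delta> E = {P. P \<subseteq> E \<times> {0<..\<delta>} \<and> disjoint_family_on (\<lambda>(x, r). cball x r) P}"

definition packing_premeasure :: "real \<Rightarrow> 'a::metric_space set \<Rightarrow> ennreal" where
  "packing_premeasure s E =
     (INF \<delta> \<in> {0<..}. SUP P \<in> packings \<delta> E. \<Sum>\<^sub>\<infinity>(x, r)\<in>P. diam_gauge s (cball x r))"

text \<open>The premeasure is only finitely subadditive; the measure is its countable regularisation.\<close>

definition packing_measure :: "real \<Rightarrow> 'a::metric_space set \<Rightarrow> ennreal" where
  "packing_measure s E =
     (INF X \<in> {X :: nat \<Rightarrow> 'a set. E \<subseteq> (\<Union>i. X i)}. \<Sum>i. packing_premeasure s (X i))"

definition packing_dim :: "'a::metric_space set \<Rightarrow> ennreal" where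
  "packing_dim E = (INF s \<in> {s. 0 \<le> s \<and> packing_measure s E = 0}. ennreal s)"

definition contracting_similarity :: "('a::metric_space \<Rightarrow> 'a) \<Rightarrow> bool" where
  "contracting_similarity f \<longleftrightarrow>
     (\<exists>r. 0 < r \<and> r < 1 \<and> (\<forall>x y. dist (f x) (f y) = r * dist x y))"

definition self_similar :: "'a::metric_space set \<Rightarrow> bool" where
  "self_similar S \<longleftrightarrow> S \<noteq> {} \<and> compact S \<and>
     (\<exists>F. finite F \<and> (\<forall>f\<in>F. contracting_similarity f) \<and> S = (\<Union>f\<in>F. f ` S))"

end

theory Submission
  imports Defs
begin

text \<open>
  Everything is read off from the null sets of the restricted contents: for \<open>D \<subseteq> (0,\<infinity>)\<close> the null
  sets of the \<open>s\<close>-content are closed under subsets and countable unions and grow with \<open>s \<ge> 0\<close>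
  (\<open>restricted_content_null_mono\<close>, \<open>restricted_content_null_UN\<close>).  Monotonicity and
  \<open>\<sigma>\<close>-stability follow for each \<open>D\<close> separately, and then for the supremum.  A cover with a small sum
  of \<open>s\<close>-th powers consists of small sets, which gives the lower bound by the Hausdorff dimension.

  For a Lipschitz map with constant \<open>L > 0\<close>, a cover of \<open>A\<close> with diameters in \<open>D/L\<close> is mapped to a
  cover of \<open>f(A)\<close> by sets of diameter at most some \<open>d \<in> D\<close>.  In a Euclidean space a bounded
  nonempty set can be thickened by closed balls so that its diameter takes any prescribed larger
  value (\<open>thickening_diameter\<close>), so the diameter can be made exactly \<open>d\<close>.

  Both upper bounds use one criterion (\<open>restricted_content_null_if_few_separated\<close>): if every
  \<open>r\<close>-separated subset of \<open>E\<close> has \<open>O(r\<^sup>-\<^sup>s)\<close> points as \<open>r \<rightarrow> 0\<close>, then \<open>E\<close> is covered by that many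
  balls of equal radius \<open>r\<close>, and one is free to take \<open>2r \<in> D\<close>; hence the \<open>t\<close>-content of \<open>E\<close> is
  zero for all \<open>t > s\<close>.
  For the packing dimension, a separated set is the set of centres of a packing, so each piece of
  finite packing premeasure meets the criterion.

  For a self-similar set \<open>S\<close> with \<open>\<H>\<^sup>s(S) = 0\<close>, take an \<open>r\<close>-separated subset of \<open>N\<close> points, \<open>r\<close> small.
  Even when the pieces of \<open>S\<close> overlap, every ball of radius \<open>r/3\<close> about one of these points
  contains a similar copy of \<open>S\<close> with ratio at least \<open>c r\<close> (\<open>self_similar_copy_at_scale\<close>), and these
  copies are \<open>r/3\<close> apart.  If \<open>N (c r)\<^sup>s > 1\<close>, there are at least two copies, the \<open>s\<close>-th powers of
  their ratios sum to at least one, and this forces every finite cover of \<open>S\<close> by bounded sets to have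
  \<open>\<Sum>|U|\<^sup>s \<ge> (r/3)\<^sup>s\<close> (\<open>finite_cover_sum_ge\<close>).  That contradicts \<open>\<H>\<^sup>s(S) = 0\<close>, because \<open>S\<close> is
  compact.  Hence \<open>N \<le> (c r)\<^sup>-\<^sup>s\<close>, as the criterion requires.
\<close>

section \<open>Null sets of the restricted content\<close>

lemma restricted_content_eq_0_iff:
  fixes E :: "'a::metric_space set"
  shows "restricted_content D s E = 0 \<longleftrightarrow>
     (\<forall>e>0. \<exists>X. E \<subseteq> (\<Union>i::nat. X i) \<and> (\<forall>i. bounded (X i) \<and> diameter (X i) \<in> D) \<and>
        (\<Sum>i. ennreal (diameter (X i) powr s)) < ennreal e)"
    (is "?L \<longleftrightarrow> ?R")
proof
  assume L: ?L
  show ?R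
  proof (intro allI impI)
    fix e :: real assume "e > 0"
    then have "restricted_content D s E < ennreal e"
      using L by simp
    then show "\<exists>X. E \<subseteq> (\<Union>i::nat. X i) \<and> (\<forall>i. bounded (X i) \<and> diameter (X i) \<in> D) \<and>
        (\<Sum>i. ennreal (diameter (X i) powr s)) < ennreal e"
      unfolding restricted_content_def INF_less_iff by blast
  qed
next
  assume R: ?R
  have "restricted_content D s E \<le> 0"
  proof (rule ennreal_le_epsilon)
    fix e :: real assume "e > 0"
    then obtain X where "E \<subseteq> (\<Union>i::nat. X i)" "\<forall>i. bounded (X i) \<and> diameter (X i) \<in> D"
        and lt: "(\<Sum>i. ennreal (diameter (X i) powr s)) < ennreal e"
      using R by blast
    then have "restricted_content D s E \<le> (\<Sum>i. ennreal (diameter (X i) powr s))"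
      unfolding restricted_content_def by (intro INF_lower) auto
    with lt show "restricted_content D s E \<le> 0 + ennreal e" by simp
  qed
  then show ?L by simp
qed

lemma suminf_ennreal_half_powers:
  assumes "(e::real) \<ge> 0"
  shows "(\<Sum>i::nat. ennreal (e * (1/2) ^ Suc i)) = ennreal e"
proof -
  have "(\<lambda>i. e * (1/2) ^ Suc i) sums e"
    using sums_mult[OF power_half_series, of e] by (simp only: mult_1_right)
  moreover have "0 \<le> e * (1/2) ^ Suc i" for i :: nat
    using assms by simp
  ultimately show ?thesis
    by (intro suminf_ennreal_eq)
qed

lemma ennreal_less_imp_term_less:
  fixes f :: "nat \<Rightarrow> ennreal"
  assumes "(\<Sum>i. f i) < c"
  shows "f i < c"
proof -
  have "sum f {i} \<le> suminf f"
    by (rule sum_le_suminf) auto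
  then show ?thesis using assms by simp
qed

lemma sum_powr_less_imp_diameter_less:
  fixes X :: "nat \<Rightarrow> 'a::metric_space set"
  assumes "(\<Sum>i. ennreal (diameter (X i) powr s)) < ennreal (\<delta> powr s)" "s \<ge> 0" "\<delta> > 0"
  shows "diameter (X i) < \<delta>"
proof (rule ccontr)
  assume "\<not> diameter (X i) < \<delta>"
  then have "\<delta> powr s \<le> diameter (X i) powr s"
    using assms by (intro powr_mono2) auto
  moreover have "ennreal (diameter (X i) powr s) < ennreal (\<delta> powr s)"
    using ennreal_less_imp_term_less[OF assms(1)] .
  ultimately show False
    by (simp add: ennreal_less_iff)
qed

text \<open>
  A cover whose sum of \<open>s\<close>-th powers is below one has all diameters below one, so that raising the
  exponent only decreases the sum.
\<close>
lemma restricted_content_null_mono: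
  fixes E :: "'a::metric_space set"
  assumes null: "restricted_content D s E = 0" and "0 \<le> s" "s \<le> t" and "D \<subseteq> {0<..}"
  shows "restricted_content D t E = 0"
  unfolding restricted_content_eq_0_iff
proof (intro allI impI)
  fix e :: real assume "e > 0"
  then have "min e 1 > 0" by simp
  then obtain X where X: "E \<subseteq> (\<Union>i::nat. X i)" "\<forall>i. bounded (X i) \<and> diameter (X i) \<in> D"
      and lt: "(\<Sum>i. ennreal (diameter (X i) powr s)) < ennreal (min e 1)"
    using null unfolding restricted_content_eq_0_iff by blast
  have "diameter (X i) < 1" for i
  proof (rule sum_powr_less_imp_diameter_less[where s = s])
    have "ennreal (min e 1) \<le> ennreal (1 powr s)"
      by (intro ennreal_leI) simp
    with lt show "(\<Sum>i. ennreal (diameter (X i) powr s)) < ennreal (1 powr s)"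
      by (rule less_le_trans)
  qed (use assms in auto)
  moreover have "diameter (X i) > 0" for i
    using X assms by auto
  ultimately have "diameter (X i) powr t \<le> diameter (X i) powr s" for i
    using assms by (intro powr_mono') (auto intro: less_imp_le)
  then have "(\<Sum>i. ennreal (diameter (X i) powr t)) \<le> (\<Sum>i. ennreal (diameter (X i) powr s))"
    by (intro suminf_le) (auto intro: ennreal_leI)
  also have "\<dots> < ennreal e"
    using lt by (rule less_le_trans) (auto intro: ennreal_leI)
  finally show "\<exists>X. E \<subseteq> (\<Union>i::nat. X i) \<and> (\<forall>i. bounded (X i) \<and> diameter (X i) \<in> D) \<and>
        (\<Sum>i. ennreal (diameter (X i) powr t)) < ennreal e"
    using X by blast
qed

lemma restricted_content_null_UN:
  fixes A :: "nat \<Rightarrow> 'a::metric_space set"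
  assumes null: "\<And>i. restricted_content D s (A i) = 0"
  shows "restricted_content D s (\<Union>i. A i) = 0"
  unfolding restricted_content_eq_0_iff
proof (intro allI impI)
  fix e :: real assume e: "e > 0"
  have "\<forall>k. \<exists>X. A k \<subseteq> (\<Union>i::nat. X i) \<and> (\<forall>i. bounded (X i) \<and> diameter (X i) \<in> D) \<and>
        (\<Sum>i. ennreal (diameter (X i) powr s)) < ennreal (e/2 * (1/2) ^ Suc k)"
  proof
    fix k
    have "e/2 * (1/2) ^ Suc k > 0" using e by simp
    then show "\<exists>X. A k \<subseteq> (\<Union>i::nat. X i) \<and> (\<forall>i. bounded (X i) \<and> diameter (X i) \<in> D) \<and>
        (\<Sum>i. ennreal (diameter (X i) powr s)) < ennreal (e/2 * (1/2) ^ Suc k)"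
      using null[of k] unfolding restricted_content_eq_0_iff by blast
  qed
  then obtain X where X: "\<And>k. A k \<subseteq> (\<Union>i::nat. X k i)"
      "\<And>k i. bounded (X k i) \<and> diameter (X k i) \<in> D"
      and lt: "\<And>k. (\<Sum>i. ennreal (diameter (X k i) powr s)) < ennreal (e/2 * (1/2) ^ Suc k)"
    by metis
  define Y where "Y n = (case prod_decode n of (k, i) \<Rightarrow> X k i)" for n
  have "(\<Union>k. A k) \<subseteq> (\<Union>n. Y n)"
  proof
    fix x assume "x \<in> (\<Union>k. A k)"
    then obtain k i where "x \<in> X k i" using X(1) by blast
    then have "x \<in> Y (prod_encode (k, i))" by (simp add: Y_def)
    then show "x \<in> (\<Union>n. Y n)" by blast
  qed
  moreover have "\<forall>n. bounded (Y n) \<and> diameter (Y n) \<in> D"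
    using X(2) by (simp add: Y_def split: prod.split)
  moreover have "(\<Sum>n. ennreal (diameter (Y n) powr s)) < ennreal e"
  proof -
    have "(\<Sum>n. ennreal (diameter (Y n) powr s)) =
          (\<Sum>n. (\<lambda>(k, i). ennreal (diameter (X k i) powr s)) (prod_decode n))"
      by (intro suminf_cong) (simp add: Y_def split: prod.split)
    also have "\<dots> = (\<Sum>k. \<Sum>i. ennreal (diameter (X k i) powr s))"
      by (subst suminf_ennreal_2dimen[symmetric, unfolded o_def,
            where g = "\<lambda>k. \<Sum>i. ennreal (diameter (X k i) powr s)"]) simp_all
    also have "\<dots> \<le> (\<Sum>k. ennreal (e/2 * (1/2) ^ Suc k))"
      using lt by (intro suminf_le) (auto intro: less_imp_le)
    also have "\<dots> = ennreal (e/2)"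
      using e by (intro suminf_ennreal_half_powers) simp
    also have "\<dots> < ennreal e"
      using e by (simp add: ennreal_less_iff)
    finally show ?thesis .
  qed
  ultimately show "\<exists>X. (\<Union>k. A k) \<subseteq> (\<Union>i::nat. X i) \<and>
      (\<forall>i. bounded (X i) \<and> diameter (X i) \<in> D) \<and>
      (\<Sum>i. ennreal (diameter (X i) powr s)) < ennreal e"
    by (intro exI[of _ Y] conjI)
qed

lemma restricted_content_mono:
  assumes "A \<subseteq> B"
  shows "restricted_content D s A \<le> restricted_content D s B"
  unfolding restricted_content_def using assms by (intro INF_superset_mono order_refl) blast

lemma sorgenfrey_familyD:
  assumes "D \<in> sorgenfrey_family"
  shows "D \<subseteq> {0<..}" and "e > 0 \<Longrightarrow> \<exists>d\<in>D. 0 < d \<and> d < e"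
proof -
  show D: "D \<subseteq> {0<..}" using assms unfolding sorgenfrey_family_def by blast
  assume "e > 0"
  moreover have "D \<noteq> {}" "Inf D = 0" using assms unfolding sorgenfrey_family_def by blast+
  moreover have "bdd_below D" using D by (intro bdd_belowI[of _ 0]) auto
  ultimately have "\<exists>d\<in>D. d < e" using cInf_less_iff[of D e] by simp
  then show "\<exists>d\<in>D. 0 < d \<and> d < e" using D by force
qed

section \<open>Comparing dimensions\<close>

lemma restricted_hausdorff_dim_le:
  assumes "\<And>t. s < t \<Longrightarrow> restricted_content D t E = 0" and "0 \<le> s"
  shows "restricted_hausdorff_dim D E \<le> ennreal s"
proof (rule ennreal_le_epsilon)
  fix e :: real assume e: "e > 0"
  have "restricted_hausdorff_dim D E \<le> ennreal (s + e)"
    unfolding restricted_hausdorff_dim_def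
    using assms e by (intro INF_lower) auto
  then show "restricted_hausdorff_dim D E \<le> ennreal s + ennreal e"
    using assms e by simp
qed

lemma restricted_content_eq_0_if_dim_less:
  assumes "restricted_hausdorff_dim D E < ennreal s" "D \<subseteq> {0<..}"
  shows "restricted_content D s E = 0"
proof -
  obtain r where r: "0 \<le> r" "restricted_content D r E = 0" "ennreal r < ennreal s"
    using assms(1) unfolding restricted_hausdorff_dim_def INF_less_iff by blast
  then have "r \<le> s" by (simp add: ennreal_less_iff)
  with r assms show ?thesis by (blast intro: restricted_content_null_mono)
qed

lemma restricted_hausdorff_dim_mono:
  assumes "A \<subseteq> B"
  shows "restricted_hausdorff_dim D A \<le> restricted_hausdorff_dim D B"
  unfolding restricted_hausdorff_dim_def
proof (rule INF_superset_mono)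
  show "{s. 0 \<le> s \<and> restricted_content D s B = 0} \<subseteq> {s. 0 \<le> s \<and> restricted_content D s A = 0}"
    using restricted_content_mono[OF assms, of D] by (metis (mono_tags, lifting) Collect_mono le_zero_eq)
qed auto

lemma universal_dim_mono:
  assumes "A \<subseteq> B"
  shows "universal_dim A \<le> universal_dim B"
  unfolding universal_dim_def using restricted_hausdorff_dim_mono[OF assms]
  by (intro SUP_mono) auto

lemma restricted_le_universal:
  "D \<in> sorgenfrey_family \<Longrightarrow> restricted_hausdorff_dim D E \<le> universal_dim E"
  unfolding universal_dim_def by (intro SUP_upper)

text \<open>
  If \<open>t\<close> exceeds the universal dimension of every \<open>A i\<close>, then for each \<open>D\<close> all the \<open>A i\<close>
  have \<open>t\<close>-content zero, and so does their union.
\<close>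
lemma universal_dim_UN:
  fixes A :: "nat \<Rightarrow> 'a::metric_space set"
  shows "universal_dim (\<Union>i. A i) = (SUP i. universal_dim (A i))"
proof (rule antisym)
  show "(SUP i. universal_dim (A i)) \<le> universal_dim (\<Union>i. A i)"
    by (intro SUP_least universal_dim_mono) auto
  show "universal_dim (\<Union>i. A i) \<le> (SUP i. universal_dim (A i))" (is "_ \<le> ?S")
    unfolding universal_dim_def[of "\<Union>i. A i"]
  proof (rule SUP_least)
    fix D assume D: "D \<in> sorgenfrey_family"
    have le: "restricted_hausdorff_dim D (A i) \<le> ?S" for i
      using restricted_le_universal[OF D] by (rule order_trans) (auto intro: SUP_upper)
    show "restricted_hausdorff_dim D (\<Union>i. A i) \<le> ?S"
    proof (cases ?S rule: ennreal_cases)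
      case (real r)
      show ?thesis
        unfolding real(2)
      proof (rule restricted_hausdorff_dim_le)
        fix t assume "r < t"
        then have "restricted_hausdorff_dim D (A i) < ennreal t" for i
          using le[of i] real by (simp add: ennreal_less_iff le_less_trans)
        then show "restricted_content D t (\<Union>i. A i) = 0"
          using sorgenfrey_familyD(1)[OF D]
          by (intro restricted_content_null_UN restricted_content_eq_0_if_dim_less)
      qed (use real in auto)
    next
      case top
      show ?thesis unfolding top by (rule top_greatest)
    qed
  qed
qed

text \<open>
  A small sum of \<open>s\<close>-th powers makes every covering set small, so that null sets of the content are
  \<open>\<H>\<^sup>s\<close>-null.  The exponent \<open>s = 0\<close> does not occur: all diameters are positive, hence
  each covering set contributes one to the sum.
\<close>
lemma hausdorff_dim_le_restricted:
  fixes E :: "'a::metric_space set"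
  assumes D: "D \<in> sorgenfrey_family"
  shows "hausdorff_dim E \<le> restricted_hausdorff_dim D E"
  unfolding hausdorff_dim_def restricted_hausdorff_dim_def
proof (rule INF_superset_mono)
  show "{s. 0 \<le> s \<and> restricted_content D s E = 0} \<subseteq> {s. 0 \<le> s \<and> hausdorff_measure s E = 0}"
  proof (intro subsetI CollectI, elim CollectE conjE, intro conjI)
    fix s :: real assume s: "0 \<le> s" and null: "restricted_content D s E = 0"
    have pos: "d > 0" if "d \<in> D" for d using sorgenfrey_familyD(1)[OF D] that by auto
    have "s \<noteq> 0"
    proof
      assume "s = 0"
      obtain X :: "nat \<Rightarrow> 'a set" where X: "\<forall>i. bounded (X i) \<and> diameter (X i) \<in> D"
          and lt: "(\<Sum>i. ennreal (diameter (X i) powr s)) < ennreal 1"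
        using null unfolding restricted_content_eq_0_iff by (meson zero_less_one)
      have "ennreal (diameter (X 0) powr s) < ennreal 1"
        using ennreal_less_imp_term_less[OF lt] .
      moreover have "diameter (X 0) powr s = 1"
        using X pos[of "diameter (X 0)"] \<open>s = 0\<close> by (simp add: less_imp_neq[symmetric])
      ultimately show False by simp
    qed
    with s have s: "s > 0" by simp
    have "hausdorff_premeasure \<delta> s E \<le> 0" if \<delta>: "\<delta> > 0" for \<delta>
    proof (rule ennreal_le_epsilon)
      fix e :: real assume "e > 0"
      then have "min e (\<delta> powr s) > 0" using \<delta> by simp
      then obtain X where X: "E \<subseteq> (\<Union>i::nat. X i)" "\<forall>i. bounded (X i) \<and> diameter (X i) \<in> D"
          and lt: "(\<Sum>i. ennreal (diameter (X i) powr s)) < ennreal (min e (\<delta> powr s))"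
        using null unfolding restricted_content_eq_0_iff by blast
      have "diameter (X i) < \<delta>" for i
      proof (rule sum_powr_less_imp_diameter_less[where s = s])
        show "(\<Sum>i. ennreal (diameter (X i) powr s)) < ennreal (\<delta> powr s)"
          using lt by (rule less_le_trans) (auto intro: ennreal_leI)
      qed (use s \<delta> in auto)
      with X have "hausdorff_premeasure \<delta> s E \<le> (\<Sum>i. diam_gauge s (X i))"
        unfolding hausdorff_premeasure_def by (intro INF_lower) (auto intro: less_imp_le)
      also have "\<dots> \<le> (\<Sum>i. ennreal (diameter (X i) powr s))"
        using s by (intro suminf_le) (auto simp: diam_gauge_def)
      also have "\<dots> \<le> ennreal e"
        using lt by (rule order_trans[OF less_imp_le]) (auto intro: ennreal_leI)
      finally show "hausdorff_premeasure \<delta> s E \<le> 0 + ennreal e" by simp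
    qed
    then show "hausdorff_measure s E = 0"
      unfolding hausdorff_measure_def by (subst SUP_eq_const[of _ _ 0]) auto
  qed auto
qed auto

section \<open>Lipschitz images\<close>

text \<open>
  The restricted content needs covering sets of diameter exactly in \<open>D\<close>; this formula tells how much
  to thicken a set that is too small.
\<close>
lemma thickening_diameter:
  fixes E :: "'a::euclidean_space set"
  assumes E: "bounded E" "E \<noteq> {}" and \<rho>: "\<rho> \<ge> 0"
  shows "bounded (\<Union>x\<in>E. cball x \<rho>)" and "diameter (\<Union>x\<in>E. cball x \<rho>) = diameter E + 2 * \<rho>"
proof -
  let ?T = "\<Union>x\<in>E. cball x \<rho>"
  obtain a R where R: "\<And>x. x \<in> E \<Longrightarrow> dist a x \<le> R" using E(1) unfolding bounded_def by blast
  have upper: "dist u v \<le> diameter E + 2 * \<rho>" if uv: "u \<in> ?T" "v \<in> ?T" for u v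
  proof -
    obtain x y where xy: "x \<in> E" "y \<in> E" "dist x u \<le> \<rho>" "dist y v \<le> \<rho>"
      using uv unfolding UN_iff mem_cball by blast
    have "dist x y \<le> diameter E" using E xy by (intro diameter_bounded_bound)
    moreover have "dist u v \<le> dist x u + dist x y + dist y v"
      by (smt (verit) dist_commute dist_triangle)
    ultimately show ?thesis using xy by linarith
  qed
  have ne: "?T \<noteq> {}" using E \<rho> by auto
  show bd: "bounded ?T"
    using upper ne unfolding bounded_def by (meson all_not_in_conv)
  show "diameter ?T = diameter E + 2 * \<rho>"
  proof (rule antisym)
    show "diameter ?T \<le> diameter E + 2 * \<rho>"
      using upper ne by (intro diameter_le) (auto simp: dist_norm)
    have "norm (x - y) \<le> diameter ?T - 2 * \<rho>" if xy: "x \<in> E" "y \<in> E" for x y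
    proof -
      \<comment> \<open>Push the two points apart by \<open>\<rho>\<close> each, along the line joining them.\<close>
      obtain u where u: "norm u = 1" "x - y = norm (x - y) *\<^sub>R u"
      proof (cases "x = y")
        case True
        obtain b :: 'a where "b \<in> Basis" using nonempty_Basis by blast
        then show ?thesis using that[of b] True by simp
      next
        case False
        then show ?thesis using that[of "(x - y) /\<^sub>R norm (x - y)"] by simp
      qed
      have "x + \<rho> *\<^sub>R u \<in> cball x \<rho>" "y - \<rho> *\<^sub>R u \<in> cball y \<rho>"
        using u(1) \<rho> by (simp_all add: dist_norm)
      then have "x + \<rho> *\<^sub>R u \<in> ?T" "y - \<rho> *\<^sub>R u \<in> ?T"
        using xy by (meson UN_I)+
      then have "dist (x + \<rho> *\<^sub>R u) (y - \<rho> *\<^sub>R u) \<le> diameter ?T"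
        by (rule diameter_bounded_bound[OF bd])
      moreover have "(x + \<rho> *\<^sub>R u) - (y - \<rho> *\<^sub>R u) = (norm (x - y) + 2 * \<rho>) *\<^sub>R u"
        using u(2) by (simp add: algebra_simps flip: scaleR_2)
      ultimately show ?thesis using u(1) \<rho> by (simp add: dist_norm)
    qed
    then have "diameter E \<le> diameter ?T - 2 * \<rho>"
      using E(2) by (intro diameter_le) auto
    then show "diameter E + 2 * \<rho> \<le> diameter ?T" by simp
  qed
qed

lemma sorgenfrey_family_scale:
  assumes D: "D \<in> sorgenfrey_family" and L: "L > 0"
  shows "{d. L * d \<in> D} \<in> sorgenfrey_family"
proof -
  let ?D = "{d. L * d \<in> D}"
  have pos: "?D \<subseteq> {0<..}"
    using sorgenfrey_familyD(1)[OF D] L by (auto simp: zero_less_mult_iff)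
  have small: "\<exists>d\<in>?D. d < e" if e: "e > 0" for e
  proof -
    obtain d where "d \<in> D" "d < L * e" using sorgenfrey_familyD(2)[OF D, of "L * e"] L e
      by (meson mult_pos_pos)
    then show ?thesis using L by (intro bexI[of _ "d / L"]) (auto simp: field_simps)
  qed
  have "?D \<noteq> {}" using small[of 1] by auto
  moreover have "Inf ?D = 0"
  proof (rule antisym)
    show "Inf ?D \<ge> 0" using pos calculation by (intro cInf_greatest) (auto intro: less_imp_le)
    show "Inf ?D \<le> 0"
    proof (rule field_le_epsilon)
      fix e :: real assume "e > 0"
      then obtain d where "d \<in> ?D" "d < e" using small by blast
      moreover have "bdd_below ?D" using pos by (intro bdd_belowI[of _ 0]) auto
      ultimately show "Inf ?D \<le> 0 + e" using cInf_lower[of d ?D] by simp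
    qed
  qed
  moreover have "\<exists>\<delta>>0. {t..<t+\<delta>} \<subseteq> ?D" if t: "t \<in> ?D" for t
  proof -
    obtain \<delta> where \<delta>: "\<delta> > 0" "{L * t..<L * t + \<delta>} \<subseteq> D"
      using t D unfolding sorgenfrey_family_def by blast
    have "L * u \<in> D" if "u \<in> {t..<t + \<delta> / L}" for u
    proof -
      have "L * u < L * (t + \<delta> / L)" using that L by simp
      also have "\<dots> = L * t + \<delta>" using L by (simp add: field_simps)
      finally show ?thesis using \<delta>(2) that L by auto
    qed
    then show ?thesis using \<delta>(1) L by (intro exI[of _ "\<delta> / L"]) auto
  qed
  ultimately show ?thesis using pos by (simp add: sorgenfrey_family_def)
qed

lemma restricted_content_lipschitz_image:
  fixes f :: "'a::metric_space \<Rightarrow> 'b::euclidean_space"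
  assumes lip: "L-lipschitz_on UNIV f" and L: "L > 0" and D: "D \<subseteq> {0<..}"
    and null: "restricted_content {d. L * d \<in> D} s A = 0"
  shows "restricted_content D s (f ` A) = 0"
  unfolding restricted_content_eq_0_iff
proof (intro allI impI)
  fix e :: real assume "e > 0"
  then have "e / L powr s > 0" using L by simp
  then obtain X where X0: "A \<subseteq> (\<Union>i::nat. X i)"
        "\<forall>i. bounded (X i) \<and> diameter (X i) \<in> {d. L * d \<in> D}"
      and lt: "(\<Sum>i. ennreal (diameter (X i) powr s)) < ennreal (e / L powr s)"
    using null unfolding restricted_content_eq_0_iff by blast
  have X: "A \<subseteq> (\<Union>i. X i)" "\<And>i. bounded (X i)" "\<And>i. L * diameter (X i) \<in> D"
    using X0 by auto
  have pos: "diameter (X i) > 0" for i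
    using X(3)[of i] D L by (auto simp: zero_less_mult_iff)
  define \<rho> where "\<rho> i = (L * diameter (X i) - diameter (f ` X i)) / 2" for i
  define Y where "Y i = (\<Union>y\<in>f ` X i. cball y (\<rho> i))" for i
  have ne: "f ` X i \<noteq> {}" for i using pos[of i] by auto
  have dist_f: "dist u v \<le> L * diameter (X i)" if uv: "u \<in> f ` X i" "v \<in> f ` X i" for u v i
  proof -
    obtain x y where xy: "x \<in> X i" "y \<in> X i" "u = f x" "v = f y" using uv by blast
    have "dist (f x) (f y) \<le> L * dist x y" using lipschitz_onD[OF lip] by simp
    also have "\<dots> \<le> L * diameter (X i)"
      using L diameter_bounded_bound[OF X(2) xy(1,2)] by simp
    finally show ?thesis using xy by simp
  qed
  have bd: "bounded (f ` X i)" for i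
    using dist_f[of _ i] ne[of i] unfolding bounded_def by (meson all_not_in_conv)
  have \<rho>: "\<rho> i \<ge> 0" for i
    using diameter_le[of "f ` X i" "L * diameter (X i)"] ne[of i] dist_f[of _ i]
    by (simp add: \<rho>_def dist_norm)
  have Y: "bounded (Y i)" "diameter (Y i) = L * diameter (X i)" for i
  proof -
    have "2 * \<rho> i = L * diameter (X i) - diameter (f ` X i)" by (simp add: \<rho>_def)
    then show "diameter (Y i) = L * diameter (X i)"
      using thickening_diameter(2)[OF bd ne \<rho>, of i i] unfolding Y_def by linarith
    show "bounded (Y i)"
      using thickening_diameter(1)[OF bd ne \<rho>] unfolding Y_def .
  qed
  have fY: "f ` X i \<subseteq> Y i" for i
  proof
    fix y assume "y \<in> f ` X i"
    moreover have "y \<in> cball y (\<rho> i)" using \<rho> by simp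
    ultimately show "y \<in> Y i" unfolding Y_def by (rule UN_I)
  qed
  have "f ` A \<subseteq> f ` (\<Union>i. X i)" using X(1) by (rule image_mono)
  also have "\<dots> \<subseteq> (\<Union>i. Y i)" unfolding image_UN using fY by (rule UN_mono[OF order_refl])
  finally have "f ` A \<subseteq> (\<Union>i. Y i)" .
  moreover have "(\<Sum>i. ennreal (diameter (Y i) powr s)) < ennreal e"
  proof -
    have "(\<Sum>i. ennreal (diameter (Y i) powr s)) =
          (\<Sum>i. ennreal (L powr s) * ennreal (diameter (X i) powr s))"
    proof (rule suminf_cong)
      fix i
      have "diameter (Y i) powr s = L powr s * diameter (X i) powr s"
        unfolding Y(2) by (rule powr_mult)
      then show "ennreal (diameter (Y i) powr s) = ennreal (L powr s) * ennreal (diameter (X i) powr s)"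
        by (simp only: ennreal_mult powr_ge_zero)
    qed
    also have "\<dots> = ennreal (L powr s) * (\<Sum>i. ennreal (diameter (X i) powr s))"
      by simp
    also have "\<dots> < ennreal (L powr s) * ennreal (e / L powr s)"
      using lt L by (intro ennreal_mult_strict_left_mono) simp_all
    also have "\<dots> = ennreal e"
      using L \<open>e > 0\<close> by (subst ennreal_mult[symmetric]) simp_all
    finally show ?thesis .
  qed
  ultimately show "\<exists>X. f ` A \<subseteq> (\<Union>i::nat. X i) \<and> (\<forall>i. bounded (X i) \<and> diameter (X i) \<in> D) \<and>
        (\<Sum>i. ennreal (diameter (X i) powr s)) < ennreal e"
    using Y X(3) by (intro exI[of _ Y] conjI allI) simp_all
qed

lemma universal_dim_lipschitz_image:
  fixes f :: "'a::metric_space \<Rightarrow> 'b::euclidean_space"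
  assumes "L-lipschitz_on UNIV f"
  shows "universal_dim (f ` A) \<le> universal_dim A"
  unfolding universal_dim_def[of "f ` A"]
proof (rule SUP_least)
  fix D assume D: "D \<in> sorgenfrey_family"
  \<comment> \<open>The scaling of \<open>D\<close> needs a positive constant.\<close>
  define M where "M = max L 1"
  have M: "M > 0" by (simp add: M_def)
  have lip: "M-lipschitz_on UNIV f"
    using assms by (rule lipschitz_on_le) (simp add: M_def)
  have "restricted_hausdorff_dim D (f ` A) \<le> restricted_hausdorff_dim {d. M * d \<in> D} A"
    unfolding restricted_hausdorff_dim_def
    using restricted_content_lipschitz_image[OF lip M sorgenfrey_familyD(1)[OF D]]
    by (intro INF_superset_mono) auto
  also have "\<dots> \<le> universal_dim A"
    by (intro restricted_le_universal sorgenfrey_family_scale D M)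
  finally show "restricted_hausdorff_dim D (f ` A) \<le> universal_dim A" .
qed

section \<open>Sets with few separated points\<close>

definition separated :: "real \<Rightarrow> 'a::metric_space set \<Rightarrow> bool" where
  "separated r P \<longleftrightarrow> (\<forall>x\<in>P. \<forall>y\<in>P. x \<noteq> y \<longrightarrow> r \<le> dist x y)"

lemma maximal_separated_set_covers:
  fixes E :: "'a::metric_space set"
  assumes bound: "\<And>P. finite P \<Longrightarrow> P \<subseteq> E \<Longrightarrow> separated r P \<Longrightarrow> real (card P) \<le> N"
    and r: "r \<ge> 0"
  obtains P where "finite P" "P \<subseteq> E" "separated r P" "E \<subseteq> (\<Union>x\<in>P. cball x r)"
proof -
  let ?Q = "\<lambda>P. finite P \<and> P \<subseteq> E \<and> separated r P"
  obtain P where P: "?Q P" and max: "\<And>R. ?Q R \<Longrightarrow> card R \<le> card P"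
  proof -
    have ex: "?Q {}" by (simp add: separated_def)
    have "\<exists>P. ?Q P \<and> (\<forall>R. ?Q R \<longrightarrow> card R \<le> card P)"
    proof (rule ex_has_greatest_nat[where k = "{}" and b = "Suc (nat \<lceil>N\<rceil>)"])
      show "\<forall>y. ?Q y \<longrightarrow> card y < Suc (nat \<lceil>N\<rceil>)"
      proof (intro allI impI)
        fix R assume "?Q R"
        then have "real (card R) \<le> N" using bound by blast
        then show "card R < Suc (nat \<lceil>N\<rceil>)" by linarith
      qed
    qed (use ex in auto)
    then show ?thesis using that by blast
  qed
  have "\<exists>y\<in>P. dist y x \<le> r" if x: "x \<in> E" for x
  proof (rule ccontr)
    assume "\<not> ?thesis"
    then have far: "\<And>y. y \<in> P \<Longrightarrow> r < dist y x" by force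
    then have "x \<notin> P" using r by fastforce
    moreover have "?Q (insert x P)"
      using P far x by (auto simp: separated_def dist_commute less_imp_le)
    ultimately show False using max[of "insert x P"] P by simp
  qed
  then show ?thesis using P that by force
qed

lemma exists_small_powr:
  assumes D: "D \<in> sorgenfrey_family" and "t > 0" "e > 0" "\<eta> > 0"
  obtains d where "d \<in> D" "0 < d" "d < \<eta>" "d powr t < e"
proof -
  have "min \<eta> (e powr (1 / t)) > 0" using assms by simp
  then obtain d where d: "d \<in> D" "0 < d" "d < min \<eta> (e powr (1 / t))"
    using sorgenfrey_familyD(2)[OF D] by blast
  then have "d powr t < (e powr (1 / t)) powr t"
    using assms by (intro powr_less_mono2) auto
  also have "\<dots> = e" using assms by (simp add: powr_powr)
  finally show ?thesis using that d by auto
qed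

text \<open>
  A maximal \<open>r\<close>-separated set gives a cover by at most \<open>C r\<^sup>-\<^sup>s\<close> balls, all of the same diameter
  \<open>2r\<close>.  Since \<open>2r\<close> may be any small element of \<open>D\<close>, the sum of the \<open>t\<close>-th powers, which is
  \<open>O(r\<^bsup>t-s\<^esup>)\<close>, becomes arbitrarily small.
\<close>
lemma restricted_content_null_if_few_separated:
  fixes E :: "'a::euclidean_space set"
  assumes D: "D \<in> sorgenfrey_family" and s: "0 \<le> s" "s < t" and r0: "r0 > 0"
    and bound: "\<And>r P. 0 < r \<Longrightarrow> r < r0 \<Longrightarrow> finite P \<Longrightarrow> P \<subseteq> E \<Longrightarrow> separated r P \<Longrightarrow>
        real (card P) * r powr s \<le> C"
  shows "restricted_content D t E = 0"
  unfolding restricted_content_eq_0_iff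
proof (intro allI impI)
  fix e :: real assume e: "e > 0"
  have t: "t > 0" using s by simp
  have C: "C \<ge> 0" using bound[of "r0/2" "{}"] r0 by (simp add: separated_def)
  \<comment> \<open>The factor \<open>2\<^sup>s\<close> passes from radii to diameters; adding one makes \<open>K\<close> a legitimate divisor.\<close>
  define K where "K = C * 2 powr s + 1"
  have K: "K > 0" using C by (simp add: K_def add_nonneg_pos)
  obtain d where d: "d \<in> D" "0 < d" "d < 2 * r0" "d powr (t - s) < e / 2 / K"
    using exists_small_powr[OF D, of "t - s" "e / 2 / K" "2 * r0"] s e K r0 by auto
  let ?r = "d / 2"
  have r: "0 < ?r" "?r < r0" using d by auto
  obtain P where P: "finite P" "P \<subseteq> E" "separated ?r P" "E \<subseteq> (\<Union>x\<in>P. cball x ?r)"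
  proof (rule maximal_separated_set_covers[of E ?r "C / ?r powr s"])
    fix P assume "finite P" "P \<subseteq> E" "separated ?r P"
    then show "real (card P) \<le> C / ?r powr s"
      using bound[OF r] r by (simp add: field_simps)
  qed (use r in auto)
  obtain h where h: "bij_betw h {..<card P} P"
    using ex_bij_betw_nat_finite[OF P(1)] by (auto simp: atLeast0LessThan)
  \<comment> \<open>The covering sequence is infinite and may not use the empty set: pad with tiny balls.\<close>
  have "\<forall>i. \<exists>d\<in>D. 0 < d \<and> d powr t < e / 4 * (1/2) ^ Suc i"
  proof
    fix i :: nat
    have "e / 4 * (1/2) ^ Suc i > 0" using e by simp
    then show "\<exists>d\<in>D. 0 < d \<and> d powr t < e / 4 * (1/2) ^ Suc i"
      using exists_small_powr[OF D t, of "e / 4 * (1/2) ^ Suc i" 1] by (metis zero_less_one)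
  qed
  then obtain p where p: "\<And>i. p i \<in> D" "\<And>i. 0 < p i"
      "\<And>i. p i powr t < e / 4 * (1/2) ^ Suc i"
    by metis
  define X where "X i = (if i < card P then cball (h i) ?r else cball 0 (p i / 2))" for i
  have diam: "diameter (X i) = (if i < card P then d else p i)" for i
    using d(2) p(2)[of i] by (simp add: X_def)
  have "E \<subseteq> (\<Union>i. X i)"
  proof
    fix x assume "x \<in> E"
    then obtain y where "y \<in> P" "x \<in> cball y ?r" using P(4) by blast
    moreover obtain i where "i < card P" "h i = y"
      using h \<open>y \<in> P\<close> unfolding bij_betw_def by (metis image_iff lessThan_iff)
    ultimately show "x \<in> (\<Union>i. X i)" by (auto simp: X_def intro!: exI[of _ i])
  qed
  moreover have "\<forall>i. bounded (X i) \<and> diameter (X i) \<in> D"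
    using d p by (simp add: diam) (simp add: X_def)
  moreover have "(\<Sum>i. ennreal (diameter (X i) powr t)) < ennreal e"
  proof -
    have "(\<Sum>i. ennreal (diameter (X i) powr t)) \<le>
          (\<Sum>i. ennreal (if i < card P then d powr t else 0) + ennreal (e / 4 * (1/2) ^ Suc i))"
    proof (intro suminf_le)
      fix i
      have "ennreal (p i powr t) \<le> ennreal (e / 4 * (1/2) ^ Suc i)"
        using p(3)[of i] by (intro ennreal_leI) simp
      then show "ennreal (diameter (X i) powr t) \<le>
          ennreal (if i < card P then d powr t else 0) + ennreal (e / 4 * (1/2) ^ Suc i)"
        by (auto simp: diam)
    qed auto
    also have "\<dots> = (\<Sum>i. ennreal (if i < card P then d powr t else 0)) +
        (\<Sum>i. ennreal (e / 4 * (1/2) ^ Suc i))"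
      by (rule suminf_add[symmetric]) auto
    also have "(\<Sum>i. ennreal (if i < card P then d powr t else 0)) =
        (\<Sum>i<card P. ennreal (if i < card P then d powr t else 0))"
      by (rule suminf_finite) auto
    also have "\<dots> = ennreal (card P * d powr t)"
      by (simp add: ennreal_mult ennreal_of_nat_eq_real_of_nat)
    also have "(\<Sum>i. ennreal (e / 4 * (1/2) ^ Suc i)) = ennreal (e / 4)"
      using e by (intro suminf_ennreal_half_powers) simp
    also have "ennreal (card P * d powr t) + ennreal (e / 4) = ennreal (card P * d powr t + e / 4)"
      using e by (simp flip: ennreal_plus)
    also have "\<dots> < ennreal e"
    proof (rule ennreal_lessI[OF e])
      have "card P * ?r powr s \<le> C" using bound[OF r P(1-3)] .
      then have "card P * d powr s \<le> C * 2 powr s"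
        using d(2) by (simp add: powr_divide field_simps)
      then have "card P * d powr s \<le> K" by (simp add: K_def)
      have "card P * d powr t = (card P * d powr s) * d powr (t - s)"
        using d(2) by (simp flip: powr_add)
      also have "\<dots> \<le> K * d powr (t - s)"
        using \<open>card P * d powr s \<le> K\<close> by (intro mult_right_mono) auto
      also have "\<dots> < e / 2"
        using d(4) K by (simp add: field_simps)
      finally show "card P * d powr t + e / 4 < e" using e by simp
    qed
    finally show ?thesis .
  qed
  ultimately show "\<exists>X. E \<subseteq> (\<Union>i::nat. X i) \<and> (\<forall>i. bounded (X i) \<and> diameter (X i) \<in> D) \<and>
        (\<Sum>i. ennreal (diameter (X i) powr t)) < ennreal e"
    by (intro exI[of _ X] conjI)
qed

section \<open>Packing dimension\<close>

text \<open>
  The closed balls of radius \<open>r/3\<close> about the points of an \<open>r\<close>-separated set are disjoint, hence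
  form a packing; a bound \<open>M\<close> on the packing sums at scale \<open>\<delta>\<close> bounds the number of points.
\<close>
lemma restricted_content_null_if_packing_premeasure_finite:
  fixes E :: "'a::euclidean_space set"
  assumes D: "D \<in> sorgenfrey_family" and s: "0 \<le> s" "s < t"
    and fin: "packing_premeasure s E < top"
  shows "restricted_content D t E = 0"
proof -
  obtain \<delta> where \<delta>: "\<delta> > 0" and
    lt: "(SUP P \<in> packings \<delta> E. \<Sum>\<^sub>\<infinity>(x, r)\<in>P. diam_gauge s (cball x r)) < top"
    using fin unfolding packing_premeasure_def INF_less_iff by auto
  then obtain M where M: "M \<ge> 0"
    "(SUP P \<in> packings \<delta> E. \<Sum>\<^sub>\<infinity>(x, r)\<in>P. diam_gauge s (cball x r)) = ennreal M"
    by (metis ennreal_cases less_irrefl)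
  show ?thesis
  proof (rule restricted_content_null_if_few_separated[OF D s])
    show "3 * \<delta> > 0" using \<delta> by simp
    fix r P assume r: "0 < r" "r < 3 * \<delta>" and P: "finite P" "P \<subseteq> E" "separated r P"
    define Q where "Q = (\<lambda>x. (x, r / 3)) ` P"
    have "cball x (r / 3) \<inter> cball y (r / 3) = {}" if xy: "x \<in> P" "y \<in> P" "x \<noteq> y" for x y
    proof -
      have "r \<le> dist x y" using P(3) xy by (auto simp: separated_def)
      then have False if "z \<in> cball x (r / 3)" "z \<in> cball y (r / 3)" for z
        using that r(1) dist_triangle[of x y z] by (simp add: dist_commute)
      then show ?thesis by blast
    qed
    then have "disjoint_family_on (\<lambda>(x, r). cball x r) Q"
      by (auto simp: disjoint_family_on_def Q_def)
    then have "Q \<in> packings \<delta> E"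
      using r P by (auto simp: packings_def Q_def)
    then have "(\<Sum>\<^sub>\<infinity>(x, r)\<in>Q. diam_gauge s (cball x r)) \<le> ennreal M"
      unfolding M(2)[symmetric] by (rule SUP_upper)
    also have "(\<Sum>\<^sub>\<infinity>(x, r)\<in>Q. diam_gauge s (cball x r)) = (\<Sum>x\<in>P. diam_gauge s (cball x (r / 3)))"
      using P(1) by (simp add: Q_def sum.reindex inj_on_def)
    also have "\<dots> = (\<Sum>x\<in>P. ennreal ((2 / 3 * r) powr s))"
      using r(1) by (intro sum.cong) (auto simp: diam_gauge_def)
    also have "\<dots> = ennreal (card P * (2 / 3 * r) powr s)"
      by (simp add: ennreal_mult ennreal_of_nat_eq_real_of_nat)
    finally have "card P * (2 / 3 * r) powr s \<le> M"
      using M(1) by simp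
    then have "(card P * r powr s) * (2 / 3) powr s \<le> M"
      by (simp only: powr_mult mult_ac)
    then show "card P * r powr s \<le> M / (2 / 3) powr s"
      by (simp add: pos_le_divide_eq)
  qed
qed

lemma universal_dim_le_packing_dim:
  fixes E :: "'a::euclidean_space set"
  shows "universal_dim E \<le> packing_dim E"
  unfolding universal_dim_def packing_dim_def
proof (intro SUP_least INF_greatest, elim CollectE conjE)
  fix D s assume D: "D \<in> sorgenfrey_family" and s: "0 \<le> s" and null: "packing_measure s E = 0"
  have "packing_measure s E < 1" using null by simp
  then obtain X where X: "E \<subseteq> (\<Union>i::nat. X i)" "(\<Sum>i. packing_premeasure s (X i)) < 1"
    unfolding packing_measure_def INF_less_iff by blast
  have fin: "packing_premeasure s (X i) < top" for i
    using ennreal_less_imp_term_less[OF X(2)] ennreal_one_less_top by (rule less_trans)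
  show "restricted_hausdorff_dim D E \<le> ennreal s"
  proof (rule restricted_hausdorff_dim_le[OF _ s])
    fix t assume t: "s < t"
    have "restricted_content D t (\<Union>i. X i) = 0"
      using restricted_content_null_if_packing_premeasure_finite[OF D s t fin]
      by (rule restricted_content_null_UN)
    then show "restricted_content D t E = 0"
      using restricted_content_mono[OF X(1), of D t] by simp
  qed
qed

section \<open>Self-similar sets\<close>

text \<open>
  Induction on the number of covering sets.  If some set has diameter at least \<open>\<delta>\<close>, there
  is nothing to do.  Otherwise no set meets two of the copies \<open>g\<^sub>j(S)\<close>, so the sets are distributed
  over the copies; as there are at least two copies, each of them receives fewer sets.
  Pulling the sets back by \<open>g\<^sub>j\<close> yields a cover of \<open>S\<close> to which the induction hypothesis applies,
  and the condition on the ratios lets the resulting bounds add up to \<open>\<delta>\<^sup>s\<close>.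
\<close>
lemma finite_cover_sum_ge:
  fixes S :: "'a::euclidean_space set" and g :: "'j \<Rightarrow> 'a \<Rightarrow> 'a" and U :: "'i \<Rightarrow> 'a set"
  assumes S: "bounded S" "S \<noteq> {}" and J: "card J \<ge> 2" and \<delta>: "\<delta> > 0" and s: "s \<ge> 0"
    and into: "\<And>j. j \<in> J \<Longrightarrow> g j ` S \<subseteq> S"
    and \<rho>: "\<And>j. j \<in> J \<Longrightarrow> \<rho> j > 0"
    and expand: "\<And>j x y. j \<in> J \<Longrightarrow> x \<in> S \<Longrightarrow> y \<in> S \<Longrightarrow> \<rho> j * dist x y \<le> dist (g j x) (g j y)"
    and sep: "\<And>j k x y. j \<in> J \<Longrightarrow> k \<in> J \<Longrightarrow> j \<noteq> k \<Longrightarrow> x \<in> S \<Longrightarrow> y \<in> S \<Longrightarrow>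
        \<delta> \<le> dist (g j x) (g k y)"
    and sum: "1 \<le> (\<Sum>j\<in>J. \<rho> j powr s)"
    and cover: "finite I" "S \<subseteq> (\<Union>i\<in>I. U i)" "\<And>i. i \<in> I \<Longrightarrow> bounded (U i)"
  shows "\<delta> powr s \<le> (\<Sum>i\<in>I. diameter (U i) powr s)"
  using cover
proof (induction "card I" arbitrary: I U rule: less_induct)
  case less
  show ?case
  proof (cases "\<exists>i\<in>I. \<delta> \<le> diameter (U i)")
    case True
    then obtain i where i: "i \<in> I" "\<delta> \<le> diameter (U i)" by blast
    then have "\<delta> powr s \<le> diameter (U i) powr s" using \<delta> s by (intro powr_mono2) auto
    also have "\<dots> \<le> (\<Sum>i\<in>I. diameter (U i) powr s)"
      using i less.prems(1) by (intro member_le_sum) auto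
    finally show ?thesis .
  next
    case False
    then have small: "diameter (U i) < \<delta>" if "i \<in> I" for i using that by force
    have finJ: "finite J" using J by (auto intro: card_ge_0_finite)
    define K where "K j = {i \<in> I. U i \<inter> g j ` S \<noteq> {}}" for j
    have finK: "finite (K j)" for j using less.prems(1) by (simp add: K_def)
    have disj: "K j \<inter> K k = {}" if jk: "j \<in> J" "k \<in> J" "j \<noteq> k" for j k
    proof (rule ccontr)
      assume "K j \<inter> K k \<noteq> {}"
      then obtain i x y where i: "i \<in> I" and xy: "x \<in> S" "y \<in> S" "g j x \<in> U i" "g k y \<in> U i"
        unfolding K_def by blast
      have "dist (g j x) (g k y) \<le> diameter (U i)"
        using less.prems(3)[OF i] xy by (intro diameter_bounded_bound)
      then show False using sep[OF jk xy(1,2)] small[OF i] by simp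
    qed
    have K_cover: "g j ` S \<subseteq> (\<Union>i\<in>K j. U i)" if "j \<in> J" for j
      using less.prems(2) into[OF that] unfolding K_def by blast
    have step: "\<rho> j powr s * \<delta> powr s \<le> (\<Sum>i\<in>K j. diameter (U i) powr s)" if j: "j \<in> J" for j
    proof -
      define V where "V i = {x \<in> S. g j x \<in> U i}" for i
      \<comment> \<open>Another copy uses up at least one covering set, hence \<open>K j\<close> is smaller than \<open>I\<close>.\<close>
      have "\<exists>k\<in>J. k \<noteq> j"
      proof (rule ccontr)
        assume "\<not> ?thesis"
        then have "J \<subseteq> {j}" by blast
        then have "card J \<le> 1" using card_mono[of "{j}" J] by simp
        then show False using J by simp
      qed
      then obtain k where k: "k \<in> J" "k \<noteq> j" by blast
      have "K k \<noteq> {}" using K_cover[OF k(1)] S(2) by auto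
      then have "K j \<subset> I" using disj[OF j k(1)] k(2) unfolding K_def by blast
      then have "card (K j) < card I" using less.prems(1) by (rule psubset_card_mono[rotated])
      moreover have "S \<subseteq> (\<Union>i\<in>K j. V i)" using K_cover[OF j] unfolding V_def by blast
      moreover have "bounded (V i)" for i
        using S(1) by (rule bounded_subset) (auto simp: V_def)
      ultimately have "\<delta> powr s \<le> (\<Sum>i\<in>K j. diameter (V i) powr s)"
        using finK by (intro less.hyps) auto
      also have "\<dots> \<le> (\<Sum>i\<in>K j. diameter (U i) powr s / \<rho> j powr s)"
      proof (rule sum_mono)
        fix i assume "i \<in> K j"
        then have bd: "bounded (U i)" using less.prems(3) by (simp add: K_def)
        have "diameter (V i) \<le> diameter (U i) / \<rho> j"
        proof (rule diameter_le)
          show "V i \<noteq> {} \<or> 0 \<le> diameter (U i) / \<rho> j"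
            using diameter_ge_0[OF bd] \<rho>[OF j] by simp
          fix x y assume xy: "x \<in> V i" "y \<in> V i"
          then have "\<rho> j * dist x y \<le> dist (g j x) (g j y)"
            using expand[OF j] by (simp add: V_def)
          also have "\<dots> \<le> diameter (U i)"
            using xy by (intro diameter_bounded_bound[OF bd]) (auto simp: V_def)
          finally show "norm (x - y) \<le> diameter (U i) / \<rho> j"
            using \<rho>[OF j] by (simp add: pos_le_divide_eq dist_norm mult.commute)
        qed
        then have "diameter (V i) powr s \<le> (diameter (U i) / \<rho> j) powr s"
          using s \<open>bounded (V i)\<close> by (intro powr_mono2 diameter_ge_0)
        also have "\<dots> = diameter (U i) powr s / \<rho> j powr s"
          using diameter_ge_0[OF bd] \<rho>[OF j] by (simp add: powr_divide)
        finally show "diameter (V i) powr s \<le> diameter (U i) powr s / \<rho> j powr s" .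
      qed
      also have "\<dots> = (\<Sum>i\<in>K j. diameter (U i) powr s) / \<rho> j powr s"
        by (simp add: sum_divide_distrib)
      finally show ?thesis
        using \<rho>[OF j] by (simp add: pos_le_divide_eq mult.commute)
    qed
    have "\<delta> powr s \<le> (\<Sum>j\<in>J. \<rho> j powr s) * \<delta> powr s"
      using sum by (simp add: mult_le_cancel_right1)
    also have "\<dots> = (\<Sum>j\<in>J. \<rho> j powr s * \<delta> powr s)"
      by (rule sum_distrib_right)
    also have "\<dots> \<le> (\<Sum>j\<in>J. \<Sum>i\<in>K j. diameter (U i) powr s)"
      using step by (rule sum_mono)
    also have "\<dots> = (\<Sum>i\<in>(\<Union>j\<in>J. K j). diameter (U i) powr s)"
      using finJ finK disj by (intro sum.UNION_disjoint[symmetric]) auto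
    also have "\<dots> \<le> (\<Sum>i\<in>I. diameter (U i) powr s)"
      using less.prems(1) by (intro sum_mono2) (auto simp: K_def)
    finally show ?thesis .
  qed
qed

lemma hausdorff_premeasure_le_measure:
  "\<delta> > 0 \<Longrightarrow> hausdorff_premeasure \<delta> s E \<le> hausdorff_measure s E"
  unfolding hausdorff_measure_def by (rule SUP_upper) simp

text \<open>
  Each covering set is replaced by an open neighbourhood so thin that the sum of the gauges
  increases by at most \<open>e/2\<close>; compactness then leaves finitely many sets.
\<close>
lemma hausdorff_null_imp_finite_cover:
  fixes S :: "'a::euclidean_space set"
  assumes S: "compact S" and null: "hausdorff_measure s S = 0" and s: "s > 0" and e: "e > 0"
  obtains I :: "nat set" and U where "finite I" "S \<subseteq> (\<Union>i\<in>I. U i)" "\<And>i. bounded (U i)"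
    "(\<Sum>i\<in>I. diameter (U i) powr s) < e"
proof -
  have "hausdorff_premeasure 1 s S < ennreal (e / 2)"
    using hausdorff_premeasure_le_measure[of 1 s S] null e by simp
  then obtain X where X: "S \<subseteq> (\<Union>i::nat. X i)" "\<forall>i. bounded (X i) \<and> diameter (X i) \<le> 1"
      and lt: "(\<Sum>i. diam_gauge s (X i)) < ennreal (e / 2)"
    unfolding hausdorff_premeasure_def INF_less_iff by blast
  have gauge: "diam_gauge s (X i) = ennreal (diameter (X i) powr s)" for i
    using s by (simp add: diam_gauge_def)
  have "\<exists>\<rho>>0. (diameter (X i) + 2 * \<rho>) powr s < diameter (X i) powr s + e/2 * (1/2) ^ Suc i" for i
  proof -
    have "((\<lambda>\<rho>. (diameter (X i) + 2 * \<rho>) powr s) \<longlongrightarrow> (diameter (X i) + 2 * 0) powr s) (at_right 0)"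
    proof (intro tendsto_powr' tendsto_intros)
      have "eventually (\<lambda>\<rho>::real. \<rho> > 0) (at_right 0)" by (simp add: eventually_at_right_less)
      then have "eventually (\<lambda>\<rho>. 0 \<le> diameter (X i) + 2 * \<rho>) (at_right 0)"
        by eventually_elim (use diameter_ge_0[of "X i"] X(2) in simp)
      then show "diameter (X i) + 2 * 0 \<noteq> 0 \<or>
          0 < s \<and> eventually (\<lambda>\<rho>. 0 \<le> diameter (X i) + 2 * \<rho>) (at_right 0)"
        using s by simp
    qed
    moreover have "(diameter (X i) + 2 * 0) powr s < diameter (X i) powr s + e/2 * (1/2) ^ Suc i"
      using e by simp
    ultimately have "eventually (\<lambda>\<rho>. (diameter (X i) + 2 * \<rho>) powr s
        < diameter (X i) powr s + e/2 * (1/2) ^ Suc i) (at_right 0)"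
      by (rule order_tendstoD(2))
    moreover have "eventually (\<lambda>\<rho>::real. \<rho> > 0) (at_right 0)" by (simp add: eventually_at_right_less)
    ultimately have "eventually (\<lambda>\<rho>. \<rho> > 0 \<and> (diameter (X i) + 2 * \<rho>) powr s
        < diameter (X i) powr s + e/2 * (1/2) ^ Suc i) (at_right 0)"
      by eventually_elim simp
    then show ?thesis
      by (rule eventually_happens'[OF trivial_limit_at_right_real])
  qed
  then obtain \<rho> where \<rho>: "\<And>i. \<rho> i > 0"
    "\<And>i. (diameter (X i) + 2 * \<rho> i) powr s < diameter (X i) powr s + e/2 * (1/2) ^ Suc i"
    by metis
  define U where "U i = (\<Union>x\<in>X i. ball x (\<rho> i))" for i
  have U: "bounded (U i) \<and> 0 \<le> diameter (U i) \<and> diameter (U i) \<le> diameter (X i) + 2 * \<rho> i" for i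
  proof (cases "X i = {}")
    case True
    then show ?thesis using \<rho>(1)[of i] by (simp add: U_def)
  next
    case False
    let ?T = "\<Union>x\<in>X i. cball x (\<rho> i)"
    have T: "bounded ?T" "diameter ?T = diameter (X i) + 2 * \<rho> i"
      using thickening_diameter[of "X i" "\<rho> i"] X(2) False \<rho>(1)[of i] by simp_all
    have "U i \<subseteq> ?T" unfolding U_def using ball_subset_cball by blast
    then show ?thesis
      using T bounded_subset[OF T(1)] diameter_subset[OF _ T(1)] diameter_ge_0 by metis
  qed
  have "S \<subseteq> (\<Union>i. U i)"
  proof
    fix x assume "x \<in> S"
    then obtain i where "x \<in> X i" using X(1) by blast
    then have "x \<in> U i" unfolding U_def using \<rho>(1)[of i] by (meson UN_I centre_in_ball)
    then show "x \<in> (\<Union>i. U i)" by blast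
  qed
  moreover have "open (U i)" for i
    unfolding U_def by (intro open_UN ballI open_ball)
  ultimately obtain I where I: "finite I" "S \<subseteq> (\<Union>i\<in>I. U i)"
    using compactE_image[OF S, of UNIV U] by metis
  have "ennreal (\<Sum>i\<in>I. diameter (U i) powr s) = (\<Sum>i\<in>I. ennreal (diameter (U i) powr s))"
    by simp
  also have "\<dots> \<le> (\<Sum>i. ennreal (diameter (U i) powr s))"
    using I(1) by (intro sum_le_suminf) auto
  also have "\<dots> \<le> (\<Sum>i. ennreal (diameter (X i) powr s) + ennreal (e/2 * (1/2) ^ Suc i))"
  proof (rule suminf_le)
    fix i
    have "diameter (U i) powr s \<le> (diameter (X i) + 2 * \<rho> i) powr s"
      using U s by (intro powr_mono2) auto
    also have "\<dots> \<le> diameter (X i) powr s + e/2 * (1/2) ^ Suc i"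
      using \<rho>(2) by (rule less_imp_le)
    finally have "ennreal (diameter (U i) powr s) \<le>
        ennreal (diameter (X i) powr s + e/2 * (1/2) ^ Suc i)"
      by (rule ennreal_leI)
    also have "\<dots> = ennreal (diameter (X i) powr s) + ennreal (e/2 * (1/2) ^ Suc i)"
      using e by (intro ennreal_plus) auto
    finally show "ennreal (diameter (U i) powr s) \<le>
        ennreal (diameter (X i) powr s) + ennreal (e/2 * (1/2) ^ Suc i)" .
  qed auto
  also have "\<dots> = (\<Sum>i. ennreal (diameter (X i) powr s)) + (\<Sum>i. ennreal (e/2 * (1/2) ^ Suc i))"
    by (rule suminf_add[symmetric]) auto
  also have "(\<Sum>i. ennreal (e/2 * (1/2) ^ Suc i)) = ennreal (e / 2)"
    using e by (intro suminf_ennreal_half_powers) simp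
  also have "(\<Sum>i. ennreal (diameter (X i) powr s)) + ennreal (e / 2) < ennreal (e / 2) + ennreal (e / 2)"
    using lt e by (simp add: gauge ennreal_add_left_cancel_less add.commute)
  also have "\<dots> = ennreal e"
    using e by (simp flip: ennreal_plus)
  finally have "(\<Sum>i\<in>I. diameter (U i) powr s) < e"
    using e by (simp add: ennreal_less_iff sum_nonneg)
  then show ?thesis using that I U by blast
qed

text \<open>
  Follow an address of \<open>x\<close>: compose the maps \<open>f\<^sub>1, f\<^sub>2, \<dots>\<close> of the system until the ratio drops to
  \<open>\<tau>\<close> or below.  The last step multiplies the ratio by at least the smallest ratio \<open>p\<close> of the system, so
  it remains at least \<open>p \<tau>\<close>.
\<close>
lemma self_similar_copy_at_scale:
  assumes "self_similar S"
  obtains p where "p > 0" "\<And>x \<tau>. x \<in> S \<Longrightarrow> 0 < \<tau> \<Longrightarrow> \<tau> \<le> 1 \<Longrightarrow>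
    \<exists>g \<rho>. g ` S \<subseteq> S \<and> x \<in> g ` S \<and> p * \<tau> \<le> \<rho> \<and> \<rho> \<le> \<tau> \<and> (\<forall>u v. dist (g u) (g v) = \<rho> * dist u v)"
proof -
  obtain F where F: "finite F" "\<And>f. f \<in> F \<Longrightarrow> contracting_similarity f" "S = (\<Union>f\<in>F. f ` S)"
    and ne: "S \<noteq> {}"
    using assms unfolding self_similar_def by blast
  obtain c where c: "\<And>f. f \<in> F \<Longrightarrow> 0 < c f" "\<And>f. f \<in> F \<Longrightarrow> c f < 1"
    "\<And>f u v. f \<in> F \<Longrightarrow> dist (f u) (f v) = c f * dist u v"
    using F(2) unfolding contracting_similarity_def by metis
  have "F \<noteq> {}" using ne F(3) by auto
  define p q where "p = Min (c ` F)" and "q = Max (c ` F)"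
  have "p \<in> c ` F" "q \<in> c ` F"
    unfolding p_def q_def using F(1) \<open>F \<noteq> {}\<close> by (auto intro: Min_in Max_in)
  then have p: "0 < p" "p \<le> 1" and q: "0 < q" "q < 1" using c by (auto intro: less_imp_le)
  have pq: "p \<le> c f" "c f \<le> q" if "f \<in> F" for f
    unfolding p_def q_def using F(1) that by auto
  \<comment> \<open>At scale \<open>q\<^sup>k\<close> or coarser, at most \<open>k\<close> maps have to be composed.\<close>
  have main: "\<exists>g \<rho>. g ` S \<subseteq> S \<and> x \<in> g ` S \<and> p * \<tau> \<le> \<rho> \<and> \<rho> \<le> \<tau> \<and>
      (\<forall>u v. dist (g u) (g v) = \<rho> * dist u v)"
    if "x \<in> S" "q ^ k \<le> \<tau>" "\<tau> \<le> 1" for k x \<tau>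
    using that
  proof (induction k arbitrary: x \<tau>)
    case 0
    then have "\<tau> = 1" by simp
    then show ?case using 0 p by (intro exI[of _ id] exI[of _ 1]) auto
  next
    case (Suc k)
    obtain f y where f: "f \<in> F" and y: "y \<in> S" "x = f y" using Suc.prems(1) F(3) by blast
    have fS: "f ` S \<subseteq> S" using f F(3) by blast
    have \<tau>: "\<tau> > 0" using Suc.prems(2) q by (meson less_le_trans zero_less_power)
    show ?case
    proof (cases "c f \<le> \<tau>")
      case True
      have "p * \<tau> \<le> p * 1" using p Suc.prems(3) by (intro mult_left_mono) auto
      also have "\<dots> \<le> c f" using pq[OF f] by simp
      finally show ?thesis
        using True fS y c(3)[OF f] by (intro exI[of _ f] exI[of _ "c f"]) auto
    next
      case False
      have "q ^ k * c f \<le> q ^ k * q" using pq[OF f] q by (intro mult_left_mono) auto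
      also have "\<dots> \<le> \<tau>" using Suc.prems(2) by (simp add: mult.commute)
      finally have "q ^ k \<le> \<tau> / c f" using c(1)[OF f] by (simp add: pos_le_divide_eq)
      moreover have "\<tau> / c f \<le> 1" using False c(1)[OF f] by simp
      ultimately obtain g \<rho> where g: "g ` S \<subseteq> S" "y \<in> g ` S" "p * (\<tau> / c f) \<le> \<rho>" "\<rho> \<le> \<tau> / c f"
          "\<And>u v. dist (g u) (g v) = \<rho> * dist u v"
        using Suc.IH[OF y(1)] by blast
      have "p * \<tau> \<le> c f * \<rho>" "c f * \<rho> \<le> \<tau>"
        using g(3,4) c(1)[OF f] by (simp_all add: field_simps)
      moreover have "(f \<circ> g) ` S \<subseteq> S" "x \<in> (f \<circ> g) ` S" using g(1,2) fS y by auto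
      moreover have "dist ((f \<circ> g) u) ((f \<circ> g) v) = c f * \<rho> * dist u v" for u v
        using c(3)[OF f] g(5) by simp
      ultimately show ?thesis by blast
    qed
  qed
  show ?thesis
  proof (rule that[OF p(1)])
    fix x \<tau> assume x: "x \<in> S" and \<tau>: "0 < \<tau>" "\<tau> \<le> (1::real)"
    obtain k where "q ^ k < \<tau>" using real_arch_pow_inv[OF \<tau>(1) q(2)] by blast
    from main[OF x less_imp_le[OF this] \<tau>(2)]
    show "\<exists>g \<rho>. g ` S \<subseteq> S \<and> x \<in> g ` S \<and> p * \<tau> \<le> \<rho> \<and> \<rho> \<le> \<tau> \<and>
        (\<forall>u v. dist (g u) (g v) = \<rho> * dist u v)" .
  qed
qed

text \<open>
  If an \<open>r\<close>-separated set had so many points that the similar copies of \<open>S\<close> near them satisfied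
  the condition of \<open>finite_cover_sum_ge\<close>, then finite covers of \<open>S\<close> could not have arbitrarily
  small sums.
\<close>
lemma restricted_content_null_if_hausdorff_null:
  fixes S :: "'a::euclidean_space set"
  assumes S: "self_similar S" and D: "D \<in> sorgenfrey_family" and s: "0 \<le> s" "s < t"
    and null: "hausdorff_measure s S = 0"
  shows "restricted_content D t S = 0"
proof -
  have cpt: "compact S" and ne: "S \<noteq> {}" using S by (auto simp: self_similar_def)
  have bd: "bounded S" using cpt by (rule compact_imp_bounded)
  have "s \<noteq> 0"
  proof
    assume "s = 0"
    have "hausdorff_premeasure 1 s S < 1"
      using hausdorff_premeasure_le_measure[of 1 s S] null by simp
    then obtain X where X: "S \<subseteq> (\<Union>i::nat. X i)" and lt: "(\<Sum>i. diam_gauge s (X i)) < 1"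
      unfolding hausdorff_premeasure_def INF_less_iff by blast
    obtain i where "X i \<noteq> {}" using X ne by blast
    then show False
      using ennreal_less_imp_term_less[OF lt, of i] \<open>s = 0\<close> by (simp add: diam_gauge_def)
  qed
  with s have s0: "s > 0" by simp
  obtain p where p: "p > 0" and copy: "\<And>x \<tau>. x \<in> S \<Longrightarrow> 0 < \<tau> \<Longrightarrow> \<tau> \<le> 1 \<Longrightarrow>
    \<exists>g \<rho>. g ` S \<subseteq> S \<and> x \<in> g ` S \<and> p * \<tau> \<le> \<rho> \<and> \<rho> \<le> \<tau> \<and> (\<forall>u v. dist (g u) (g v) = \<rho> * dist u v)"
    using self_similar_copy_at_scale[OF S] by blast
  \<comment> \<open>Strictly larger than the diameter, hence positive even if \<open>S\<close> is a single point.\<close>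
  define R where "R = diameter S + 1"
  have R: "R > 0" "diameter S < R" using diameter_ge_0[OF bd] by (simp_all add: R_def)
  define c where "c = p / (3 * R)"
  have c: "c > 0" using p R by (simp add: c_def)
  show ?thesis
  proof (rule restricted_content_null_if_few_separated[OF D s])
    \<comment> \<open>\<open>r < 3R\<close> makes the scale \<open>\<tau>\<close> at most one; \<open>r < 1/c\<close> makes \<open>c r\<close> at most one, so that a sum
       of \<open>(c r)\<^sup>s\<close> above one has at least two terms.\<close>
    show "min (3 * R) (1 / c) > 0" using R c by simp
    fix r P assume r: "0 < r" "r < min (3 * R) (1 / c)" and P: "finite P" "P \<subseteq> S" "separated r P"
    have "card P * (c * r) powr s \<le> 1"
    proof (rule ccontr)
      assume "\<not> ?thesis"
      then have gt: "card P * (c * r) powr s > 1" by simp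
      have "(c * r) powr s \<le> 1 powr s"
        using r c s by (intro powr_mono2) (auto simp: field_simps)
      then have "card P * (c * r) powr s \<le> real (card P) * 1"
        by (intro mult_left_mono) auto
      with gt have card: "card P \<ge> 2" by simp
      define \<tau> where "\<tau> = r / (3 * R)"
      have \<tau>: "0 < \<tau>" "\<tau> \<le> 1" and p\<tau>: "p * \<tau> = c * r" using r R by (simp_all add: \<tau>_def c_def)
      have "\<exists>g \<rho>. g ` S \<subseteq> S \<and> x \<in> g ` S \<and> p * \<tau> \<le> \<rho> \<and> \<rho> \<le> \<tau> \<and>
          (\<forall>u v. dist (g u) (g v) = \<rho> * dist u v)" if "x \<in> P" for x
        using copy[OF _ \<tau>, of x] P(2) that by blast
      then obtain g \<rho> where g: "\<And>x. x \<in> P \<Longrightarrow> g x ` S \<subseteq> S" "\<And>x. x \<in> P \<Longrightarrow> x \<in> g x ` S"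
        and \<rho>: "\<And>x. x \<in> P \<Longrightarrow> c * r \<le> \<rho> x" "\<And>x. x \<in> P \<Longrightarrow> \<rho> x \<le> \<tau>"
        and sim: "\<And>x u v. x \<in> P \<Longrightarrow> dist (g x u) (g x v) = \<rho> x * dist u v"
        unfolding p\<tau> by metis
      have cr: "c * r > 0" using c r by simp
      have near: "dist x (g x u) < r / 3" if x: "x \<in> P" and u: "u \<in> S" for x u
      proof -
        obtain w where w: "w \<in> S" "x = g x w" using g(2)[OF x] by blast
        have "dist x (g x u) = \<rho> x * dist w u" using sim[OF x, of w u] w(2) by simp
        also have "\<dots> \<le> \<tau> * diameter S"
          using \<rho>(2)[OF x] \<tau> diameter_bounded_bound[OF bd w(1) u] by (intro mult_mono) auto
        also have "\<dots> < \<tau> * R" using R \<tau> by simp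
        also have "\<dots> = r / 3" using R by (simp add: \<tau>_def)
        finally show ?thesis .
      qed
      have apart: "r / 3 \<le> dist (g x u) (g y v)"
        if xy: "x \<in> P" "y \<in> P" "x \<noteq> y" and uv: "u \<in> S" "v \<in> S" for x y u v
      proof -
        have "r \<le> dist x y" using P(3) xy by (auto simp: separated_def)
        also have "\<dots> \<le> dist x (g x u) + dist (g x u) (g y v) + dist y (g y v)"
          by (smt (verit) dist_commute dist_triangle)
        finally show ?thesis using near[OF xy(1) uv(1)] near[OF xy(2) uv(2)] by linarith
      qed
      have "card P * (c * r) powr s = (\<Sum>x\<in>P. (c * r) powr s)" by simp
      also have "\<dots> \<le> (\<Sum>x\<in>P. \<rho> x powr s)"
        using \<rho>(1) cr s by (intro sum_mono powr_mono2) auto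
      finally have sum: "1 \<le> (\<Sum>x\<in>P. \<rho> x powr s)" using gt by linarith
      have "(r / 3) powr s > 0" using r by simp
      then obtain I :: "nat set" and U where IU: "finite I" "S \<subseteq> (\<Union>i\<in>I. U i)" "\<And>i. bounded (U i)"
          "(\<Sum>i\<in>I. diameter (U i) powr s) < (r / 3) powr s"
        using hausdorff_null_imp_finite_cover[OF cpt null s0] by metis
      have "(r / 3) powr s \<le> (\<Sum>i\<in>I. diameter (U i) powr s)"
      proof (rule finite_cover_sum_ge[where g = g and \<rho> = \<rho> and J = P and S = S])
        show "\<rho> x > 0" if "x \<in> P" for x using \<rho>(1)[OF that] cr by simp
      qed (use bd ne card r s g sim apart sum IU in auto)
      with IU(4) show False by simp
    qed
    then have "(card P * r powr s) * c powr s \<le> 1"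
      using r(1) c by (simp add: powr_mult mult_ac)
    then show "card P * r powr s \<le> 1 / c powr s"
      using c by (simp add: pos_le_divide_eq)
  qed
qed

lemma universal_dim_self_similar:
  fixes S :: "'a::euclidean_space set"
  assumes S: "self_similar S"
  shows "universal_dim S = hausdorff_dim S"
proof (rule antisym)
  show "universal_dim S \<le> hausdorff_dim S"
    unfolding universal_dim_def hausdorff_dim_def
  proof (intro SUP_least INF_greatest, elim CollectE conjE)
    fix D s assume "D \<in> sorgenfrey_family" "0 \<le> s" "hausdorff_measure s S = 0"
    then show "restricted_hausdorff_dim D S \<le> ennreal s"
      using restricted_content_null_if_hausdorff_null[OF S]
      by (intro restricted_hausdorff_dim_le)
  qed
  have D: "{0<..} \<in> sorgenfrey_family"
  proof -
    have "{t..<t+1} \<subseteq> {0<..}" if "t > 0" for t :: real using that by auto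
    then show ?thesis
      unfolding sorgenfrey_family_def by (auto intro!: exI[of _ "1::real"])
  qed
  show "hausdorff_dim S \<le> universal_dim S"
    using hausdorff_dim_le_restricted[OF D] restricted_le_universal[OF D] by (rule order_trans)
qed

theorem proposition4p2:
  shows "(\<forall>(A :: (real ^ 'n) set) (f :: real ^ 'n \<Rightarrow> real ^ 'n).
            (\<exists>L. L-lipschitz_on UNIV f) \<longrightarrow> universal_dim (f ` A) \<le> universal_dim A)
       \<and> (\<forall>(A :: (real ^ 'n) set) B. A \<subseteq> B \<longrightarrow> universal_dim A \<le> universal_dim B)
       \<and> (\<forall>S :: (real ^ 'n) set. self_similar S \<longrightarrow> universal_dim S = hausdorff_dim S)
       \<and> (\<forall>A :: nat \<Rightarrow> (real ^ 'n) set. universal_dim (\<Union>i. A i) = (SUP i. universal_dim (A i)))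
       \<and> (\<forall>(E :: (real ^ 'n) set). \<forall>D\<in>sorgenfrey_family.
            hausdorff_dim E \<le> restricted_hausdorff_dim D E
          \<and> restricted_hausdorff_dim D E \<le> universal_dim E
          \<and> universal_dim E \<le> packing_dim E)"
proof (intro conjI allI ballI impI)
  fix A :: "(real ^ 'n) set" and f :: "real ^ 'n \<Rightarrow> real ^ 'n"
  assume "\<exists>L. L-lipschitz_on UNIV f"
  then obtain L where "L-lipschitz_on UNIV f" ..
  then show "universal_dim (f ` A) \<le> universal_dim A" by (rule universal_dim_lipschitz_image)
qed (fact universal_dim_mono universal_dim_self_similar universal_dim_UN
    hausdorff_dim_le_restricted restricted_le_universal | rule universal_dim_le_packing_dim)+

end
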